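(* Let $Z^{\mathrm{IP}}$ be the minimum total shortest-path distance of a perfect bipartite matching between the supply set $U$ and the demand set $V$ on the network, and let $Z^{\mathrm{CF}}$ be the optimal value of the integer flow problem $$\min_{\mathbf c\in\mathbb Z^{|\mathcal E|}}\ \sum_{e\in\mathcal E}\Psi_e(c_e;S_e)\quad\text{s.t.}\quad \mathbf I\mathbf c=\mathbf I^+\mathbf s .$$ Then $Z^{\mathrm{IP}}=Z^{\mathrm{CF}}$.
   Context: $(\mathcal V,\mathcal E)$ is an undirected network. Each edge $e\in\mathcal E$ has length $l_e\ge 0$ and end nodes $v_e^-,v_e^+\in\mathcal V$ (an arbitrary orientation from $v_e^-$ to $v_e^+$ is fixed). A location on $e$ is recorded as $(e,x)$, $x\in[0,l_e]$, where $x$ is the distance from $v_e^-$ along $e$. Put $\mathcal L_e(x)=\{(e,y):y\in[0,x]\}$ and $\mathcal L=\bigcup_{e}\mathcal L_e(l_e)$. $U,V\subset\mathcal L$ are finite sets of supply and demand points with $|U|=|V|=n$, and $d(\cdot,\cdot)$ is the shortest-path distance along the network. The matching problem is $$Z^{\mathrm{IP}}=\min\ \sum_{u\in U}\sum_{v\in V}y_{uv}d(u,v)\ \text{ s.t. }\ \sum_{u\in U}y_{uv}=1\ \forall v\in V,\ \ \sum_{v\in V}y_{uv}=1\ \forall u\in U,\ \ y_{uv}\in\{0,1\}.$$ The imbalance profile of edge $e$ is $S_e(x)=|U\cap\mathcal L_e(x)|-|V\cap\mathcal L_e(x)|$ for $x\in[0,l_e]$, and $\mathbf s=(S_e(l_e))_{e\in\mathcal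 E}$. For a profile $\xi_e:[0,l_e]\to\mathbb R$ and $c\in\mathbb R$, $\Psi_e(c;\xi_e)=\int_0^{l_e}|\xi_e(x)-c|\,dx$. $\mathbf I^+$ (resp. $\mathbf I^-$) is the $\mathcal V\times\mathcal E$ matrix whose $(v,e)$ entry is $1$ if $v_e^+=v$ (resp. $v_e^-=v$) and $0$ otherwise; $\mathbf I=\mathbf I^+-\mathbf I^-$. *)

theory Defs
  imports "HOL-Analysis.Analysis" "Graph_Theory.Digraph"
begin

text \<open>
  An undirected network is a finite multigraph \<^term>\<open>G\<close> together with a length function
  \<open>l\<close> on its edges. The arcs of \<^term>\<open>G\<close> are the edges with their fixed orientation: the tail
  of \<open>e\<close> is $v_e^-$ and its head is $v_e^+$. The orientation only fixes coordinates; routes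
  traverse edges in both directions.
\<close>

type_synonym 'e location = "'e \<times> real"

definition initial_part :: "'e \<Rightarrow> real \<Rightarrow> 'e location set" where
  "initial_part e x = {(e, y) | y. y \<in> {0..x}}"

definition locations :: "('v, 'e) pre_digraph \<Rightarrow> ('e \<Rightarrow> real) \<Rightarrow> 'e location set" where
  "locations G l = (\<Union>e\<in>arcs G. initial_part e (l e))"

definition at_node ::
  "('v, 'e) pre_digraph \<Rightarrow> ('e \<Rightarrow> real) \<Rightarrow> 'e location \<Rightarrow> 'v \<Rightarrow> bool" where
  "at_node G l a v \<longleftrightarrow>
     a \<in> locations G l \<and>
     (snd a = 0 \<and> tail G (fst a) = v \<or> snd a = l (fst a) \<and> head G (fst a) = v)"

text \<open>
  \<open>route G l a b r\<close>: there is a path of length \<open>r\<close> along the network from \<open>a\<close> to \<open>b\<close>. A path is a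
  concatenation of segments inside edges; it changes from one edge to another at a common node,
  where different locations may represent the same physical point.
\<close>
inductive route ::
  "('v, 'e) pre_digraph \<Rightarrow> ('e \<Rightarrow> real) \<Rightarrow> 'e location \<Rightarrow> 'e location \<Rightarrow> real \<Rightarrow> bool"
  for G :: "('v, 'e) pre_digraph" and l :: "'e \<Rightarrow> real" where
  along_edge: "(e, x) \<in> locations G l \<Longrightarrow> (e, y) \<in> locations G l \<Longrightarrow>
    route G l (e, x) (e, y) \<bar>x - y\<bar>"
| through_node: "at_node G l a v \<Longrightarrow> at_node G l b v \<Longrightarrow> route G l a b 0"
| concat: "route G l a b r \<Longrightarrow> route G l b c s \<Longrightarrow> route G l a c (r + s)"

text \<open>
  The distance is \<^term>\<open>\<infinity>\<close> between locations in different components, so that connectedness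
  need not be assumed.
\<close>
definition network_dist ::
  "('v, 'e) pre_digraph \<Rightarrow> ('e \<Rightarrow> real) \<Rightarrow> 'e location \<Rightarrow> 'e location \<Rightarrow> ereal" where
  "network_dist G l a b = Inf {ereal r | r. route G l a b r}"

definition matching_feasible ::
  "'e location set \<Rightarrow> 'e location set \<Rightarrow> ('e location \<Rightarrow> 'e location \<Rightarrow> real) \<Rightarrow> bool" where
  "matching_feasible U V y \<longleftrightarrow>
     (\<forall>v\<in>V. (\<Sum>u\<in>U. y u v) = 1) \<and>
     (\<forall>u\<in>U. (\<Sum>v\<in>V. y u v) = 1) \<and>
     (\<forall>u\<in>U. \<forall>v\<in>V. y u v \<in> {0, 1})"

definition matching_cost ::
  "('v, 'e) pre_digraph \<Rightarrow> ('e \<Rightarrow> real) \<Rightarrow> 'e location set \<Rightarrow> 'e location set \<Rightarrow>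
   ('e location \<Rightarrow> 'e location \<Rightarrow> real) \<Rightarrow> ereal" where
  "matching_cost G l U V y = (\<Sum>u\<in>U. \<Sum>v\<in>V. ereal (y u v) * network_dist G l u v)"

definition Z_IP ::
  "('v, 'e) pre_digraph \<Rightarrow> ('e \<Rightarrow> real) \<Rightarrow> 'e location set \<Rightarrow> 'e location set \<Rightarrow> ereal" where
  "Z_IP G l U V = Inf {matching_cost G l U V y | y. matching_feasible U V y}"

definition imbalance :: "'e location set \<Rightarrow> 'e location set \<Rightarrow> 'e \<Rightarrow> real \<Rightarrow> int" where
  "imbalance U V e x = int (card (U \<inter> initial_part e x)) - int (card (V \<inter> initial_part e x))"

definition Psi :: "('e \<Rightarrow> real) \<Rightarrow> 'e \<Rightarrow> real \<Rightarrow> (real \<Rightarrow> real) \<Rightarrow> real" where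
  "Psi l e c \<xi> = integral {0..l e} (\<lambda>x. \<bar>\<xi> x - c\<bar>)"

definition incidence_plus :: "('v, 'e) pre_digraph \<Rightarrow> 'v \<Rightarrow> 'e \<Rightarrow> int" where
  "incidence_plus G v e = (if head G e = v then 1 else 0)"

definition incidence_minus :: "('v, 'e) pre_digraph \<Rightarrow> 'v \<Rightarrow> 'e \<Rightarrow> int" where
  "incidence_minus G v e = (if tail G e = v then 1 else 0)"

definition incidence :: "('v, 'e) pre_digraph \<Rightarrow> 'v \<Rightarrow> 'e \<Rightarrow> int" where
  "incidence G v e = incidence_plus G v e - incidence_minus G v e"

definition flow_feasible ::
  "('v, 'e) pre_digraph \<Rightarrow> ('e \<Rightarrow> real) \<Rightarrow> 'e location set \<Rightarrow> 'e location set \<Rightarrow>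
   ('e \<Rightarrow> int) \<Rightarrow> bool" where
  "flow_feasible G l U V c \<longleftrightarrow>
     (\<forall>v\<in>verts G.
        (\<Sum>e\<in>arcs G. incidence G v e * c e) =
        (\<Sum>e\<in>arcs G. incidence_plus G v e * imbalance U V e (l e)))"

definition flow_cost ::
  "('v, 'e) pre_digraph \<Rightarrow> ('e \<Rightarrow> real) \<Rightarrow> 'e location set \<Rightarrow> 'e location set \<Rightarrow>
   ('e \<Rightarrow> int) \<Rightarrow> real" where
  "flow_cost G l U V c =
     (\<Sum>e\<in>arcs G. Psi l e (real_of_int (c e)) (\<lambda>x. real_of_int (imbalance U V e x)))"

text \<open>The optimal value is \<^term>\<open>\<infinity>\<close> if there is no feasible flow.\<close>
definition Z_CF ::
  "('v, 'e) pre_digraph \<Rightarrow> ('e \<Rightarrow> real) \<Rightarrow> 'e location set \<Rightarrow> 'e location set \<Rightarrow> ereal" where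
  "Z_CF G l U V = Inf {ereal (flow_cost G l U V c) | c. flow_feasible G l U V c}"

end

theory Submission
  imports Defs
begin

text \<open>
  From a matching to a flow: along a route from \<open>a\<close> to \<open>b\<close>, one unit of flow can be sent at cost at
  most the length of the route (induction on the route), and superposing the unit flows of the matched
  pairs gives a feasible \<open>c\<close> whose cost is at most that of the matching.

  From a flow to a matching: on edge \<open>e\<close> the net flow at \<open>x\<close> in the direction of the orientation is
  \<open>S\<^sub>e(x) - c\<^sub>e\<close>. Subdividing the edges at the points of \<open>U\<close> and \<open>V\<close> turns it into an integral flow
  on a finite graph. Treat the supplies as tokens. As long as some location carries more tokens than
  demand, an arc with flow leaves it; move a token along that arc and decrease the flow by one. The
  total flow strictly decreases, so in the end every token sits on its own demand point, and the
  distance travelled is at most the cost of the flow.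

  The minimum of the flow problem is attained because the cost only depends on \<open>c\<^sub>e\<close> for edges of
  positive length, and on those a bound on the cost bounds \<open>c\<^sub>e\<close>.
\<close>

subsection \<open>Token moving\<close>

text \<open>Kronecker delta. A flow \<open>f a\<close> from \<open>t a\<close> to \<open>h a\<close>
  contributes \<open>f a * (point_mass (t a) x - point_mass (h a) x)\<close> to the net outflow at
  \<open>x\<close>, so loops cancel.\<close>

definition point_mass :: "'a \<Rightarrow> 'a \<Rightarrow> int" where
  "point_mass a w = (if a = w then 1 else 0)"

text \<open>
  The tokens \<open>U\<close> start at arbitrary positions \<open>p\<close>, so that the induction can move them. A negative
  \<open>f a\<close> is flow against the direction of the arc \<open>a\<close>.
\<close>

lemma flow_matching:
  fixes t h :: "'a \<Rightarrow> 'n" and f :: "'a \<Rightarrow> int" and w :: "'a \<Rightarrow> real"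
    and p :: "'u \<Rightarrow> 'n" and R :: "'n \<Rightarrow> 'n \<Rightarrow> real \<Rightarrow> bool"
  assumes fin: "finite A" "finite U" "finite V" and card: "card U = card V"
    and balance: "\<And>x. (\<Sum>a\<in>A. f a * (point_mass (t a) x - point_mass (h a) x)) =
      (\<Sum>u\<in>U. point_mass (p u) x) - (\<Sum>v\<in>V. point_mass v x)"
    and fwd: "\<And>a. a \<in> A \<Longrightarrow> R (t a) (h a) (w a)"
    and bwd: "\<And>a. a \<in> A \<Longrightarrow> R (h a) (t a) (w a)"
    and refl: "\<And>v. v \<in> V \<Longrightarrow> R v v 0"
    and trans: "\<And>x y z r s. R x y r \<Longrightarrow> R y z s \<Longrightarrow> R x z (r + s)"
    and nonneg: "\<And>a. a \<in> A \<Longrightarrow> 0 \<le> w a"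
  shows "\<exists>\<sigma> r. bij_betw \<sigma> U V \<and> (\<forall>u\<in>U. R (p u) (\<sigma> u) (r u)) \<and>
    (\<Sum>u\<in>U. r u) \<le> (\<Sum>a\<in>A. real_of_int \<bar>f a\<bar> * w a)"
  using balance
proof (induction "nat (\<Sum>a\<in>A. \<bar>f a\<bar>)" arbitrary: f p rule: less_induct)
  case less
  show ?case
  proof (cases "\<exists>x. (\<Sum>u\<in>U. point_mass (p u) x) > (\<Sum>v\<in>V. point_mass v x)")
    case False
    have V: "(\<Sum>v\<in>V. point_mass v x) = (if x \<in> V then 1 else 0)" for x
      using fin by (simp add: point_mass_def)
    have le: "(\<Sum>u\<in>U. point_mass (p u) x) \<le> (if x \<in> V then 1 else 0)" for x
      using False V[of x] by (metis not_le)
    have ge: "(\<Sum>u\<in>W. point_mass (p u) x) \<le> (\<Sum>u\<in>U. point_mass (p u) x)" if "W \<subseteq> U" for W x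
      using that fin by (intro sum_mono2) (auto simp: point_mass_def)
    have "inj_on p U"
    proof (rule inj_onI, rule ccontr)
      fix u u' assume *: "u \<in> U" "u' \<in> U" "p u = p u'" "u \<noteq> u'"
      have "(\<Sum>u\<in>{u, u'}. point_mass (p u) (p u)) = 2"
        using * by (simp add: point_mass_def)
      then show False
        using ge[of "{u, u'}" "p u"] le[of "p u"] * by (auto simp: point_mass_def split: if_splits)
    qed
    moreover have "p ` U \<subseteq> V"
    proof clarify
      fix u assume "u \<in> U"
      then show "p u \<in> V"
        using ge[of "{u}" "p u"] le[of "p u"] by (auto simp: point_mass_def split: if_splits)
    qed
    ultimately have bij: "bij_betw p U V"
      using card fin by (metis bij_betw_def card_image card_subset_eq)
    then have "\<forall>u\<in>U. R (p u) (p u) 0"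
      using refl by (auto dest: bij_betwE)
    moreover have "(\<Sum>u\<in>U. 0) \<le> (\<Sum>a\<in>A. real_of_int \<bar>f a\<bar> * w a)"
      using nonneg by (simp add: sum_nonneg)
    ultimately show ?thesis
      using bij by (intro exI[of _ p] exI[of _ "\<lambda>_. 0"]) blast
  next
    case True
    then obtain x where x: "(\<Sum>u\<in>U. point_mass (p u) x) > (\<Sum>v\<in>V. point_mass v x)" by blast
    moreover have "(\<Sum>v\<in>V. point_mass v x) \<ge> 0" by (simp add: sum_nonneg point_mass_def)
    ultimately have "(\<Sum>u\<in>U. point_mass (p u) x) \<noteq> 0" by simp
    then obtain u where u: "u \<in> U" "p u = x"
      by (auto simp: point_mass_def elim!: sum.not_neutral_contains_not_neutral split: if_splits)
    have "(\<Sum>a\<in>A. f a * (point_mass (t a) x - point_mass (h a) x)) > 0"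
      using x less.prems by simp
    then obtain a where a: "a \<in> A" "f a * (point_mass (t a) x - point_mass (h a) x) > 0"
      by (meson not_le sum_nonpos)
    \<comment> \<open>\<open>s\<close> is the sign of \<open>f a\<close>: one unit of flow leaves
      \<open>x\<close> along \<open>a\<close> or against it, and \<open>y\<close> is the opposite
      end.\<close>
    obtain s y where s: "\<bar>f a\<bar> = \<bar>f a - s\<bar> + 1" and R: "R x y (w a)"
      and push: "\<And>z. s * (point_mass (t a) z - point_mass (h a) z) = point_mass x z - point_mass y z"
    proof (cases "f a > 0")
      case True
      with a have "t a = x" by (auto simp: point_mass_def zero_less_mult_iff split: if_splits)
      with True a fwd show ?thesis by (intro that[of 1 "h a"]) auto
    next
      case False
      with a have "f a < 0" "h a = x"
        by (auto simp: point_mass_def zero_less_mult_iff split: if_splits)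
      with a bwd show ?thesis by (intro that[of "-1" "t a"]) auto
    qed
    let ?f = "f(a := f a - s)" and ?p = "p(u := y)"
    have sum_f: "(\<Sum>b\<in>A. F b (?f b)) = (\<Sum>b\<in>A. F b (f b)) - F a (f a) + F a (f a - s)"
      for F :: "_ \<Rightarrow> int \<Rightarrow> 'z::ab_group_add"
      using a fin by (simp add: sum.remove[of A a])
    have sum_p: "(\<Sum>b\<in>U. F (?p b)) = (\<Sum>b\<in>U. F (p b)) - F x + F y"
      for F :: "_ \<Rightarrow> int"
      using u fin by (simp add: sum.remove[of U u])
    have "(\<Sum>b\<in>A. \<bar>?f b\<bar>) = (\<Sum>b\<in>A. \<bar>f b\<bar>) - 1"
      using s sum_f[of "\<lambda>_ c. \<bar>c\<bar>"] by linarith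
    moreover have "(\<Sum>b\<in>A. \<bar>?f b\<bar>) \<ge> 0" by (simp add: sum_nonneg)
    ultimately have dec: "nat (\<Sum>b\<in>A. \<bar>?f b\<bar>) < nat (\<Sum>b\<in>A. \<bar>f b\<bar>)" by linarith
    have bal: "(\<Sum>a\<in>A. ?f a * (point_mass (t a) z - point_mass (h a) z)) =
      (\<Sum>u\<in>U. point_mass (?p u) z) - (\<Sum>v\<in>V. point_mass v z)" for z
      using sum_f[of "\<lambda>a c. c * (point_mass (t a) z - point_mass (h a) z)"]
        sum_p[of "\<lambda>q. point_mass q z"] push[of z] less.prems[of z]
      by (simp add: left_diff_distrib)
    obtain \<sigma> r where \<sigma>: "bij_betw \<sigma> U V" and r: "\<And>b. b \<in> U \<Longrightarrow> R (?p b) (\<sigma> b) (r b)"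
      and cost: "sum r U \<le> (\<Sum>a\<in>A. real_of_int \<bar>?f a\<bar> * w a)"
      using less.hyps[OF dec bal] by blast
    \<comment> \<open>Token \<open>u\<close> first crosses \<open>a\<close>, at length
      \<open>w a\<close>, and then follows the route that the induction hypothesis gives from
      \<open>y\<close>.\<close>
    let ?r = "r(u := w a + r u)"
    have "R (p b) (\<sigma> b) (?r b)" if "b \<in> U" for b
      using r[OF that] R trans u by (cases "b = u") auto
    moreover have "sum ?r U = w a + sum r U"
      using u fin by (simp add: sum.remove[of U u])
    moreover have "(\<Sum>a\<in>A. real_of_int \<bar>?f a\<bar> * w a) = (\<Sum>a\<in>A. real_of_int \<bar>f a\<bar> * w a) - w a"
      using sum_f[of "\<lambda>a c. real_of_int \<bar>c\<bar> * w a"] s by (simp add: left_diff_distrib distrib_right)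
    ultimately show ?thesis
      using \<sigma> cost by (intro exI[of _ \<sigma>] exI[of _ ?r]) auto
  qed
qed

subsection \<open>From matchings to flows\<close>

text \<open>The imbalance profile of a lone supply at \<open>a\<close>. The profiles of
  \<open>U\<close> and \<open>V\<close> are sums of these unit steps, which allows routes to be
  treated one matched pair at a time.\<close>

definition passed :: "'e location \<Rightarrow> 'e \<Rightarrow> real \<Rightarrow> int" where
  "passed a e x = (if a \<in> initial_part e x then 1 else 0)"

lemma passed_Pair: "passed (e', y) e x = (if e' = e \<and> 0 \<le> y \<and> y \<le> x then 1 else 0)"
  by (auto simp: passed_def initial_part_def)

lemma locations_Pair: "(e, x) \<in> locations G l \<longleftrightarrow> e \<in> arcs G \<and> 0 \<le> x \<and> x \<le> l e"
  by (auto simp: locations_def initial_part_def)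

lemma imbalance_eq_passed:
  assumes "finite U" "finite V"
  shows "imbalance U V e x = (\<Sum>u\<in>U. passed u e x) - (\<Sum>v\<in>V. passed v e x)"
  using assms by (simp add: imbalance_def passed_def flip: sum.inter_restrict)

lemma passed_integrable:
  "(\<lambda>x. real_of_int (passed a e x)) absolutely_integrable_on {0..L}"
proof -
  obtain e' y where a: "a = (e', y)" by (cases a)
  have "mono_on {0..L} (\<lambda>x. real_of_int (passed a e x))"
    by (auto simp: a passed_Pair mono_on_def)
  then show ?thesis
    by (intro nonnegative_absolutely_integrable_1 integrable_on_mono_on) (auto simp: passed_def)
qed

section \<open>Conservation and cost for general integer profiles\<close>

definition flow_balanced :: "('v, 'e) pre_digraph \<Rightarrow> ('e \<Rightarrow> int) \<Rightarrow> ('e \<Rightarrow> int) \<Rightarrow> bool" where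
  "flow_balanced G s c \<longleftrightarrow> (\<forall>v\<in>verts G.
     (\<Sum>e\<in>arcs G. incidence G v e * c e) = (\<Sum>e\<in>arcs G. incidence_plus G v e * s e))"

text \<open>The L1 norm of a profile on the network. Together with \<open>flow_balanced\<close> for
  arbitrary \<open>s\<close>, it allows the flows of single pairs to be superposed: conservation is
  linear in \<open>s\<close> and \<open>c\<close> jointly, and the cost obeys the triangle
  inequality.\<close>

definition profile_cost :: "('v, 'e) pre_digraph \<Rightarrow> ('e \<Rightarrow> real) \<Rightarrow> ('e \<Rightarrow> real \<Rightarrow> int) \<Rightarrow> real" where
  "profile_cost G l h = (\<Sum>e\<in>arcs G. integral {0..l e} (\<lambda>x. \<bar>real_of_int (h e x)\<bar>))"

lemma flow_feasible_iff:
  "flow_feasible G l U V c \<longleftrightarrow> flow_balanced G (\<lambda>e. imbalance U V e (l e)) c"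
  by (simp add: flow_feasible_def flow_balanced_def)

lemma flow_cost_eq: "flow_cost G l U V c = profile_cost G l (\<lambda>e x. imbalance U V e x - c e)"
  by (simp add: flow_cost_def profile_cost_def Psi_def)

lemma flow_balanced_add:
  assumes "flow_balanced G s c" "flow_balanced G s' c'"
  shows "flow_balanced G (\<lambda>e. s e + s' e) (\<lambda>e. c e + c' e)"
  using assms by (simp add: flow_balanced_def distrib_left sum.distrib)

lemma flow_balanced_sum:
  assumes "finite U" "\<And>u. u \<in> U \<Longrightarrow> flow_balanced G (s u) (c u)"
  shows "flow_balanced G (\<lambda>e. \<Sum>u\<in>U. s u e) (\<lambda>e. \<Sum>u\<in>U. c u e)"
  using assms
proof (induction U rule: finite_induct)
  case empty
  then show ?case by (simp add: flow_balanced_def)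
next
  case (insert u U)
  then show ?case using flow_balanced_add[of G "s u" "c u"] by simp
qed

definition profile_integrable :: "('v, 'e) pre_digraph \<Rightarrow> ('e \<Rightarrow> real) \<Rightarrow> ('e \<Rightarrow> real \<Rightarrow> int) \<Rightarrow> bool" where
  "profile_integrable G l h \<longleftrightarrow>
     (\<forall>e\<in>arcs G. (\<lambda>x. real_of_int (h e x)) absolutely_integrable_on {0..l e})"

lemma profile_integrable_diff:
  "profile_integrable G l h \<Longrightarrow> profile_integrable G l h' \<Longrightarrow>
    profile_integrable G l (\<lambda>e x. h e x - h' e x)"
  by (simp add: profile_integrable_def)

lemma profile_integrable_sum:
  "finite U \<Longrightarrow> (\<And>u. u \<in> U \<Longrightarrow> profile_integrable G l (h u)) \<Longrightarrow>
    profile_integrable G l (\<lambda>e x. \<Sum>u\<in>U. h u e x)"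
  by (simp add: profile_integrable_def absolutely_integrable_sum)

lemma profile_integrable_const: "profile_integrable G l (\<lambda>e x. c e)"
  by (simp add: profile_integrable_def absolutely_integrable_on_const)

lemma profile_integrable_passed: "profile_integrable G l (passed a)"
  by (simp add: profile_integrable_def passed_integrable)

lemma profile_cost_add:
  assumes "profile_integrable G l h" "profile_integrable G l h'"
  shows "profile_cost G l (\<lambda>e x. h e x + h' e x) \<le> profile_cost G l h + profile_cost G l h'"
  unfolding profile_cost_def sum.distrib[symmetric]
proof (rule sum_mono)
  fix e assume e: "e \<in> arcs G"
  let ?I = "integral {0..l e}"
  have h: "(\<lambda>x. real_of_int (h e x)) absolutely_integrable_on {0..l e}"
    and h': "(\<lambda>x. real_of_int (h' e x)) absolutely_integrable_on {0..l e}"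
    using assms e by (auto simp: profile_integrable_def)
  have abs: "(\<lambda>x. \<bar>f x\<bar>) integrable_on {0..l e}" if "f absolutely_integrable_on {0..l e}" for f :: "real \<Rightarrow> real"
    using that by (simp add: absolutely_integrable_on_def)
  have "?I (\<lambda>x. \<bar>real_of_int (h e x + h' e x)\<bar>) \<le>
    ?I (\<lambda>x. \<bar>real_of_int (h e x)\<bar> + \<bar>real_of_int (h' e x)\<bar>)"
    using abs[OF set_integral_add(1)[OF h h']] abs[OF h] abs[OF h']
    by (intro integral_le integrable_add) auto
  also have "\<dots> = ?I (\<lambda>x. \<bar>real_of_int (h e x)\<bar>) + ?I (\<lambda>x. \<bar>real_of_int (h' e x)\<bar>)"
    using abs[OF h] abs[OF h'] by (rule integral_add)
  finally show "?I (\<lambda>x. \<bar>real_of_int (h e x + h' e x)\<bar>) \<le>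
    ?I (\<lambda>x. \<bar>real_of_int (h e x)\<bar>) + ?I (\<lambda>x. \<bar>real_of_int (h' e x)\<bar>)" .
qed

lemma profile_cost_sum:
  assumes "finite U" "\<And>u. u \<in> U \<Longrightarrow> profile_integrable G l (h u)"
  shows "profile_cost G l (\<lambda>e x. \<Sum>u\<in>U. h u e x) \<le> (\<Sum>u\<in>U. profile_cost G l (h u))"
  using assms
proof (induction U rule: finite_induct)
  case empty
  then show ?case by (simp add: profile_cost_def)
next
  case (insert u U)
  then have "profile_cost G l (\<lambda>e x. h u e x + (\<Sum>u\<in>U. h u e x)) \<le>
    profile_cost G l (h u) + profile_cost G l (\<lambda>e x. \<Sum>u\<in>U. h u e x)"
    by (intro profile_cost_add profile_integrable_sum) auto
  with insert show ?case by fastforce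
qed

text \<open>
  A supply that sits at the end of an edge representing \<open>v\<close> is equivalent to a supply at \<open>v\<close> itself:
  the flow \<open>k\<close> brings it from \<open>a\<close> to \<open>v\<close> for free and violates the balance only at \<open>v\<close>.
\<close>

lemma at_node_flow:
  assumes "fin_digraph G" "\<And>e. e \<in> arcs G \<Longrightarrow> 0 \<le> l e" "at_node G l a v"
  shows "\<exists>k. (\<forall>w. (\<Sum>e\<in>arcs G. incidence G w e * k e) =
      (\<Sum>e\<in>arcs G. incidence_plus G w e * passed a e (l e)) - (if v = w then 1 else 0)) \<and>
    profile_cost G l (\<lambda>e x. passed a e x - k e) = 0"
proof -
  interpret fin_digraph G by fact
  obtain e0 y where a: "a = (e0, y)" by (cases a)
  have e0: "e0 \<in> arcs G" "0 \<le> y" "y \<le> l e0"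
    and ends: "y = 0 \<and> tail G e0 = v \<or> y = l e0 \<and> head G e0 = v"
    using assms(3) by (auto simp: a at_node_def locations_Pair)
  have s: "passed a e (l e) = (if e = e0 then 1 else 0)" for e
    using e0 by (auto simp: a passed_Pair)
  from ends show ?thesis
  proof
    \<comment> \<open>A supply at coordinate 0 has profile 1 on the whole edge, so
      \<open>k = 1\<close> there cancels it; the incidence of \<open>e0\<close> then leaves only the
      tail term at \<open>v\<close>.\<close>
    assume y: "y = 0 \<and> tail G e0 = v"
    show ?thesis
    proof (intro exI[of _ "\<lambda>e. if e = e0 then 1 else 0"] conjI allI)
      show "(\<Sum>e\<in>arcs G. incidence G w e * (if e = e0 then 1 else 0)) =
        (\<Sum>e\<in>arcs G. incidence_plus G w e * passed a e (l e)) - (if v = w then 1 else 0)" for w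
        using y e0 by (simp add: s mult_delta_right incidence_def incidence_minus_def)
      have "integral {0..l e} (\<lambda>x. \<bar>real_of_int (passed a e x - (if e = e0 then 1 else 0))\<bar>) =
        integral {0..l e} (\<lambda>x. 0)" for e
        using y by (intro integral_cong) (auto simp: a passed_Pair)
      then show "profile_cost G l (\<lambda>e x. passed a e x - (if e = e0 then 1 else 0)) = 0"
        by (simp add: profile_cost_def)
    qed
  next
    \<comment> \<open>A supply at the head enters the profile only at the last point of the edge, a
      null set, so \<open>k = 0\<close> costs nothing.\<close>
    assume y: "y = l e0 \<and> head G e0 = v"
    show ?thesis
    proof (intro exI[of _ "\<lambda>e. 0"] conjI allI)
      show "(\<Sum>e\<in>arcs G. incidence G w e * 0) =
        (\<Sum>e\<in>arcs G. incidence_plus G w e * passed a e (l e)) - (if v = w then 1 else 0)" for w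
        using y e0 by (simp add: s mult_delta_right incidence_plus_def)
      have "integral {0..l e} (\<lambda>x. \<bar>real_of_int (passed a e x - 0)\<bar>) =
        integral {0..l e} (\<lambda>x. 0)" for e
        by (rule integral_spike[of "{l e}"]) (use y in \<open>auto simp: a passed_Pair\<close>)
      then show "profile_cost G l (\<lambda>e x. passed a e x - 0) = 0"
        by (simp add: profile_cost_def)
    qed
  qed
qed

text \<open>A unit sent from \<open>a\<close> to \<open>b\<close> has profile
  \<open>passed a - passed b\<close>. Inside an edge this is, up to sign, the indicator of the
  segment, and \<open>c = 0\<close> suffices. At a node the flows of \<open>at_node_flow\<close> are
  subtracted, which cancels their defects at \<open>v\<close>. For concatenated routes the
  contributions of the intermediate location cancel.\<close>

lemma route_flow:
  assumes "route G l a b r" "fin_digraph G" "\<And>e. e \<in> arcs G \<Longrightarrow> 0 \<le> l e"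
  shows "\<exists>c. flow_balanced G (\<lambda>e. passed a e (l e) - passed b e (l e)) c \<and>
    profile_cost G l (\<lambda>e x. passed a e x - passed b e x - c e) \<le> r"
  using assms(1)
proof induction
  case (along_edge e0 x y)
  interpret fin_digraph G by fact
  have loc: "e0 \<in> arcs G" "0 \<le> x" "x \<le> l e0" "0 \<le> y" "y \<le> l e0"
    using along_edge by (auto simp: locations_Pair)
  have "passed (e0, x) e (l e) - passed (e0, y) e (l e) = 0" for e
    using loc by (auto simp: passed_Pair)
  then have bal: "flow_balanced G (\<lambda>e. passed (e0, x) e (l e) - passed (e0, y) e (l e)) (\<lambda>e. 0)"
    by (simp add: flow_balanced_def)
  let ?I = "\<lambda>e. integral {0..l e} (\<lambda>z. \<bar>real_of_int (passed (e0, x) e z - passed (e0, y) e z - 0)\<bar>)"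
  let ?m = "min x y" and ?M = "max x y"
  have "((\<lambda>z. 1) has_integral (?M - ?m)) {?m..?M}"
    using has_integral_const_real[of "1::real" ?m ?M] by (simp split: if_splits)
  then have "((\<lambda>z. if z \<in> {?m..?M} then 1 else 0) has_integral (?M - ?m)) {0..l e0}"
    using loc by (subst has_integral_restrict) auto
  \<comment> \<open>The difference has modulus 1 on the segment without its right end, since a
    location is counted from its own coordinate on; finitely many points do not affect the
    integral.\<close>
  then have "((\<lambda>z. \<bar>real_of_int (passed (e0, x) e0 z - passed (e0, y) e0 z - 0)\<bar>)
      has_integral (?M - ?m)) {0..l e0}"
    by (rule has_integral_spike_finite[of "{x, y}", rotated 2])
      (use loc in \<open>auto simp: passed_Pair\<close>)
  then have I0: "?I e0 = \<bar>x - y\<bar>"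
    by (simp add: integral_unique)
  have "?I e = 0" if "e \<noteq> e0" for e
    using that by (simp add: passed_Pair)
  then have "(\<Sum>e\<in>arcs G. ?I e) = (\<Sum>e\<in>arcs G. if e = e0 then \<bar>x - y\<bar> else 0)"
    using I0 by (intro sum.cong) auto
  with bal loc show ?case
    by (intro exI[of _ "\<lambda>e. 0"]) (simp add: profile_cost_def)
next
  case (through_node a v b)
  obtain j where j:
      "\<And>w. (\<Sum>e\<in>arcs G. incidence G w e * j e) =
        (\<Sum>e\<in>arcs G. incidence_plus G w e * passed a e (l e)) - (if v = w then 1 else 0)"
      "profile_cost G l (\<lambda>e x. passed a e x - j e) = 0"
    using at_node_flow[OF assms(2,3) through_node(1)] by blast
  obtain k where k:
      "\<And>w. (\<Sum>e\<in>arcs G. incidence G w e * k e) =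
        (\<Sum>e\<in>arcs G. incidence_plus G w e * passed b e (l e)) - (if v = w then 1 else 0)"
      "profile_cost G l (\<lambda>e x. passed b e x - k e) = 0"
    using at_node_flow[OF assms(2,3) through_node(2)] by blast
  have "flow_balanced G (\<lambda>e. passed a e (l e) - passed b e (l e)) (\<lambda>e. j e - k e)"
    using j(1) k(1) by (simp add: flow_balanced_def right_diff_distrib sum_subtractf)
  moreover have "profile_cost G l (\<lambda>e x. (passed a e x - j e) + (k e - passed b e x)) \<le>
      profile_cost G l (\<lambda>e x. passed a e x - j e) + profile_cost G l (\<lambda>e x. k e - passed b e x)"
    by (intro profile_cost_add profile_integrable_diff profile_integrable_passed
        profile_integrable_const)
  moreover have "profile_cost G l (\<lambda>e x. k e - passed b e x) = 0"
    using k(2) by (simp add: profile_cost_def abs_minus_commute)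
  ultimately show ?case
    using j(2) by (intro exI[of _ "\<lambda>e. j e - k e"]) (simp add: algebra_simps)
next
  case (concat a b r d s)
  then obtain c c' where
    c: "flow_balanced G (\<lambda>e. passed a e (l e) - passed b e (l e)) c"
      "profile_cost G l (\<lambda>e x. passed a e x - passed b e x - c e) \<le> r"
    and c': "flow_balanced G (\<lambda>e. passed b e (l e) - passed d e (l e)) c'"
      "profile_cost G l (\<lambda>e x. passed b e x - passed d e x - c' e) \<le> s"
    by blast
  have "flow_balanced G (\<lambda>e. passed a e (l e) - passed d e (l e)) (\<lambda>e. c e + c' e)"
    using flow_balanced_add[OF c(1) c'(1)] by simp
  moreover have "profile_cost G l (\<lambda>e x. (passed a e x - passed b e x - c e) +
      (passed b e x - passed d e x - c' e)) \<le> r + s"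
    by (intro order_trans[OF profile_cost_add add_mono[OF c(2) c'(2)]] profile_integrable_diff
        profile_integrable_passed profile_integrable_const)
  ultimately show ?case
    by (intro exI[of _ "\<lambda>e. c e + c' e"]) (simp add: algebra_simps)
qed

lemma matching_to_flow:
  assumes G: "fin_digraph G" "\<And>e. e \<in> arcs G \<Longrightarrow> 0 \<le> l e"
    and fin: "finite U" "finite V" and \<sigma>: "bij_betw \<sigma> U V"
    and routes: "\<And>u. u \<in> U \<Longrightarrow> route G l u (\<sigma> u) (r u)"
  obtains c where "flow_feasible G l U V c" "flow_cost G l U V c \<le> sum r U"
proof -
  have "\<forall>u\<in>U. \<exists>c. flow_balanced G (\<lambda>e. passed u e (l e) - passed (\<sigma> u) e (l e)) c \<and>
      profile_cost G l (\<lambda>e x. passed u e x - passed (\<sigma> u) e x - c e) \<le> r u"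
    using route_flow[OF routes G] by blast
  from bchoice[OF this] obtain c where "\<forall>u\<in>U.
      flow_balanced G (\<lambda>e. passed u e (l e) - passed (\<sigma> u) e (l e)) (c u) \<and>
      profile_cost G l (\<lambda>e x. passed u e x - passed (\<sigma> u) e x - c u e) \<le> r u" ..
  then have c: "\<And>u. u \<in> U \<Longrightarrow>
      flow_balanced G (\<lambda>e. passed u e (l e) - passed (\<sigma> u) e (l e)) (c u)"
    and cost: "\<And>u. u \<in> U \<Longrightarrow>
      profile_cost G l (\<lambda>e x. passed u e x - passed (\<sigma> u) e x - c u e) \<le> r u"
    by simp_all
  \<comment> \<open>Reindexing the demands by \<open>\<sigma>\<close> pairs each supply with its
    partner and splits the imbalance into one term per pair.\<close>
  have imb: "imbalance U V e x = (\<Sum>u\<in>U. passed u e x - passed (\<sigma> u) e x)" for e x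
    using sum.reindex_bij_betw[OF \<sigma>, of "\<lambda>v. passed v e x"]
    by (simp add: imbalance_eq_passed[OF fin] sum_subtractf)
  let ?c = "\<lambda>e. \<Sum>u\<in>U. c u e"
  have "flow_feasible G l U V ?c"
    unfolding flow_feasible_iff imb using fin(1) c by (rule flow_balanced_sum)
  moreover have "flow_cost G l U V ?c =
      profile_cost G l (\<lambda>e x. \<Sum>u\<in>U. passed u e x - passed (\<sigma> u) e x - c u e)"
    by (simp add: flow_cost_eq imb sum_subtractf)
  moreover have "\<dots> \<le> (\<Sum>u\<in>U. profile_cost G l (\<lambda>e x. passed u e x - passed (\<sigma> u) e x - c u e))"
    by (intro profile_cost_sum fin profile_integrable_diff profile_integrable_passed
        profile_integrable_const)
  moreover have "\<dots> \<le> sum r U"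
    using cost by (rule sum_mono)
  ultimately show ?thesis using that by force
qed

subsection \<open>From flows to matchings\<close>

text \<open>Lists the cut points of an edge in increasing order. For \<open>L = 0\<close> there is a
  single point and \<open>k = 0\<close>.\<close>

lemma finite_grid:
  fixes L :: real
  assumes "finite T" "0 \<in> T" "L \<in> T" "T \<subseteq> {0..L}"
  obtains \<tau> :: "nat \<Rightarrow> real" and k where
    "\<tau> 0 = 0" "\<tau> k = L" "strict_mono_on {..k} \<tau>" "\<tau> ` {..k} = T"
proof -
  define xs where "xs = sorted_list_of_set T"
  define k where "k = length xs - 1"
  have set: "set xs = T" and sorted: "sorted xs" and strict: "sorted_wrt (<) xs"
    using assms by (simp_all add: xs_def strict_sorted_list_of_set)
  then have "xs \<noteq> []" using assms by auto
  then have k: "{..k} = {..<length xs}" "k < length xs" by (cases xs; auto simp: k_def)+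
  have img: "(!) xs ` {..k} = T"
    using set k by (auto simp: set_conv_nth)
  have mono: "strict_mono_on {..k} ((!) xs)"
    using strict k by (auto simp: strict_mono_on_def sorted_wrt_iff_nth_less)
  obtain i j where ij: "i \<le> k" "xs ! i = 0" "j \<le> k" "xs ! j = L"
    using assms(2,3) unfolding img[symmetric] by fastforce
  have "xs ! 0 \<in> T" "xs ! k \<in> T" unfolding img[symmetric] by simp_all
  then have bounds: "xs ! 0 \<ge> 0" "xs ! k \<le> L" using assms(4) by auto
  have "xs ! 0 \<le> xs ! i" "xs ! j \<le> xs ! k"
    using sorted_nth_mono[OF sorted, of 0 i] sorted_nth_mono[OF sorted, of j k] ij k(2) by simp_all
  then have "xs ! 0 = 0" "xs ! k = L"
    using bounds ij by linarith+
  then show ?thesis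
    using that[of "(!) xs" k] mono img by blast
qed

text \<open>Applied to a path whose arc \<open>i\<close> carries \<open>f i\<close>: the net outflow
  is expressed by the jumps of \<open>f\<close> at the inner vertices and by boundary terms at the
  two end vertices.\<close>

lemma summation_by_parts:
  fixes f g :: "nat \<Rightarrow> 'a::comm_ring"
  shows "(\<Sum>i\<le>m. f i * (g i - g (Suc i))) =
    f 0 * g 0 + (\<Sum>i<m. (f (Suc i) - f i) * g (Suc i)) - f m * g (Suc m)"
  by (induction m) (simp_all add: algebra_simps)

text \<open>
  The path \<open>n 0, \<dots>, n (m + 1)\<close> runs from \<open>P\<close> through the subdivision points of \<open>e\<close> to \<open>Q\<close>, where \<open>P\<close> and
  \<open>Q\<close> represent the end nodes of \<open>e\<close>; its first and last arcs have length 0 and carry the flows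
  \<open>- c\<close> and \<open>S\<^sub>e(l\<^sub>e) - c\<close> exchanged with the end nodes.
\<close>

lemma edge_path:
  assumes e: "e \<in> arcs G"
    and U: "finite U" "U \<subseteq> locations G l" and V: "finite V" "V \<subseteq> locations G l"
    and l: "0 \<le> l e" and P: "at_node G l P (tail G e)" and Q: "at_node G l Q (head G e)"
  shows "\<exists>m n f w.
    (\<forall>i\<le>m. route G l (n i) (n (Suc i)) (w i) \<and> route G l (n (Suc i)) (n i) (w i) \<and> 0 \<le> w i) \<and>
    (\<forall>x. (\<Sum>i\<le>m. f i * (point_mass (n i) x - point_mass (n (Suc i)) x)) =
      (\<Sum>u\<in>U. if fst u = e then point_mass u x else 0) -
      (\<Sum>v\<in>V. if fst v = e then point_mass v x else 0) -
      c * point_mass P x - (imbalance U V e (l e) - c) * point_mass Q x) \<and>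
    (\<Sum>i\<le>m. real_of_int \<bar>f i\<bar> * w i) =
      integral {0..l e} (\<lambda>x. \<bar>real_of_int (imbalance U V e x - c)\<bar>)"
proof -
  define T where "T = {0, l e} \<union> snd ` {a \<in> U \<union> V. fst a = e}"
  have "finite T" "0 \<in> T" "l e \<in> T" "T \<subseteq> {0..l e}"
    using U V l by (auto simp: T_def locations_Pair)
  then obtain \<tau> :: "nat \<Rightarrow> real" and k where \<tau>: "\<tau> 0 = 0" "\<tau> k = l e" and mono: "strict_mono_on {..k} \<tau>"
    and img: "\<tau> ` {..k} = T"
    by (rule finite_grid) blast
  have less: "\<tau> i < \<tau> j \<longleftrightarrow> i < j" if "i \<le> k" "j \<le> k" for i j
    using strict_mono_on_less[OF mono] that by auto
  have le: "\<tau> i \<le> \<tau> j \<longleftrightarrow> i \<le> j" if "i \<le> k" "j \<le> k" for i j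
    using strict_mono_on_less_eq[OF mono] that by auto
  have loc: "(e, \<tau> i) \<in> locations G l" if "i \<le> k" for i
    using le[of 0 i] le[of i k] \<tau> that e by (simp add: locations_Pair)
  have grid: "\<exists>j\<le>k. a = (e, \<tau> j)" if "a \<in> U \<union> V" "fst a = e" for a
  proof -
    have "snd a \<in> T" using that by (auto simp: T_def)
    then obtain j where "j \<le> k" "snd a = \<tau> j" using img by auto
    with that show ?thesis by (metis prod.collapse)
  qed
  \<comment> \<open>\<open>x\<close> ranges over the half-open cell starting at
    \<open>\<tau> i\<close>, matching the right-continuity of the profiles; the last cell
    \<open>i = k\<close> starts at \<open>l e\<close> and has no right bound.\<close>
  have passed_grid: "passed (e, \<tau> j) e x = (if j \<le> i then 1 else 0)"
    if "j \<le> k" "i \<le> k" "\<tau> i \<le> x" "i < k \<Longrightarrow> x < \<tau> (Suc i)" for i j x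
  proof (cases "j \<le> i")
    case True
    with that le[of j i] le[of 0 j] \<tau> show ?thesis by (auto simp: passed_Pair)
  next
    case False
    with that le[of "Suc i" j] show ?thesis by (auto simp: passed_Pair)
  qed
  have passed_const: "passed a e x = passed a e (\<tau> i)"
    if a: "a \<in> U \<union> V" and that: "i < k" "\<tau> i \<le> x" "x < \<tau> (Suc i)" for a i x
  proof (cases "fst a = e")
    case True
    obtain j where "j \<le> k" "a = (e, \<tau> j)" using grid[OF a True] by auto
    with that less[of i "Suc i"] show ?thesis
      using passed_grid[of j i x] passed_grid[of j i "\<tau> i"] by simp
  next
    case False
    then show ?thesis by (cases a) (simp add: passed_Pair)
  qed
  have imb_const: "imbalance U V e x = imbalance U V e (\<tau> i)"
    if x: "i < k" "\<tau> i \<le> x" "x < \<tau> (Suc i)" for i x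
  proof -
    have "(\<Sum>a\<in>W. passed a e x) = (\<Sum>a\<in>W. passed a e (\<tau> i))" if "W \<subseteq> U \<union> V" for W
      by (rule sum.cong[OF refl passed_const[OF _ x]]) (use that in blast)
    from this[of U] this[of V] show ?thesis
      by (simp only: imbalance_eq_passed[OF U(1) V(1)] Un_upper1 Un_upper2)
  qed
  \<comment> \<open>Indices are shifted by one: for \<open>1 \<le> i \<le> k\<close>, arc
    \<open>i\<close> joins \<open>\<tau> (i - 1)\<close> to \<open>\<tau> i\<close>, and
    \<open>S i\<close> is the profile on that cell. Arcs 0 and \<open>Suc k\<close> attach the path
    to \<open>P\<close> and \<open>Q\<close>; \<open>S 0 = 0\<close> because no location precedes
    the start of the edge.\<close>
  define n where "n i = (if i = 0 then P else if i = Suc (Suc k) then Q else (e, \<tau> (i - 1)))" for i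
  define S where "S i = (if i = 0 then 0 else imbalance U V e (\<tau> (i - 1)))" for i
  define w where "w i = (if i = 0 \<or> i = Suc k then 0 else \<tau> i - \<tau> (i - 1))" for i
  have route: "route G l (n i) (n (Suc i)) (w i) \<and> route G l (n (Suc i)) (n i) (w i) \<and> 0 \<le> w i"
    if i: "i \<le> Suc k" for i
  proof -
    consider "i = 0" | "i = Suc k" | "i \<noteq> 0" "i < Suc k"
      using i by linarith
    then show ?thesis
    proof cases
      case 1
      have "at_node G l (e, \<tau> 0) (tail G e)"
        using loc[of 0] \<tau> by (simp add: at_node_def)
      with P 1 show ?thesis by (auto simp: n_def w_def intro: through_node)
    next
      case 2
      have "at_node G l (e, \<tau> k) (head G e)"
        using loc[of k] \<tau> by (simp add: at_node_def)
      with Q 2 show ?thesis by (auto simp: n_def w_def intro: through_node)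
    next
      case 3
      then obtain j where "i = Suc j" "j < k" by (cases i) auto
      with less[of j "Suc j"] along_edge[OF loc[of j] loc[of "Suc j"]]
        along_edge[OF loc[of "Suc j"] loc[of j]]
      show ?thesis by (auto simp: n_def w_def)
    qed
  qed
  \<comment> \<open>The jump of \<open>passed a\<close> at \<open>\<tau> i\<close>. Before
    \<open>\<tau> 0\<close> nothing has been passed, so a location at coordinate 0 also counts as a
    jump. Since all locations of \<open>U\<close> and \<open>V\<close> on \<open>e\<close> are cut
    points, the jumps pick out exactly their positions.\<close>
  define J where "J a i = passed a e (\<tau> i) - (if i = 0 then 0 else passed a e (\<tau> (i - 1)))" for a i
  have jump: "(\<Sum>i<Suc k. J a i * point_mass (e, \<tau> i) x) = (if fst a = e then point_mass a x else 0)"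
    if a: "a \<in> U \<union> V" for a x
  proof (cases "fst a = e")
    case True
    obtain j where j: "j \<le> k" "a = (e, \<tau> j)" using grid[OF a True] by auto
    have "J a i = (if i = j then 1 else 0)" if "i < Suc k" for i
    proof -
      have p: "passed a e (\<tau> i') = (if j \<le> i' then 1 else 0)" if "i' \<le> k" for i'
        using j that less[of i' "Suc i'"] passed_grid[of j i' "\<tau> i'"] by simp
      show ?thesis using that by (auto simp: p J_def)
    qed
    then have "(\<Sum>i<Suc k. J a i * point_mass (e, \<tau> i) x) =
      (\<Sum>i<Suc k. if i = j then point_mass (e, \<tau> i) x else 0)"
      by (intro sum.cong) auto
    also have "\<dots> = point_mass (e, \<tau> j) x"
      using j(1) by (subst sum.delta) auto
    finally show ?thesis using j(2) by simp
  next
    case False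
    then have "passed a e z = 0" for z by (cases a) (simp add: passed_Pair)
    then have "J a i = 0" for i by (simp add: J_def)
    with False show ?thesis by simp
  qed
  have J_sum: "(\<Sum>i<Suc k. (\<Sum>a\<in>W. J a i) * point_mass (e, \<tau> i) x) =
      (\<Sum>a\<in>W. if fst a = e then point_mass a x else 0)" if "W \<subseteq> U \<union> V" for W x
  proof -
    have "(\<Sum>i<Suc k. (\<Sum>a\<in>W. J a i) * point_mass (e, \<tau> i) x) =
        (\<Sum>a\<in>W. \<Sum>i<Suc k. J a i * point_mass (e, \<tau> i) x)"
      unfolding sum_distrib_right by (rule sum.swap)
    also have "\<dots> = (\<Sum>a\<in>W. if fst a = e then point_mass a x else 0)"
      using that by (intro sum.cong refl jump) auto
    finally show ?thesis .
  qed
  have "S (Suc i) - S i = (\<Sum>u\<in>U. J u i) - (\<Sum>v\<in>V. J v i)" for i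
    by (simp add: S_def J_def imbalance_eq_passed U V sum_subtractf)
  then have S_sum: "(\<Sum>i<Suc k. (S (Suc i) - S i) * point_mass (e, \<tau> i) x) =
      (\<Sum>u\<in>U. if fst u = e then point_mass u x else 0) -
      (\<Sum>v\<in>V. if fst v = e then point_mass v x else 0)" for x
    by (simp only: left_diff_distrib sum_subtractf J_sum Un_upper1 Un_upper2)
  have balance: "(\<Sum>i\<le>Suc k. (S i - c) * (point_mass (n i) x - point_mass (n (Suc i)) x)) =
      (\<Sum>u\<in>U. if fst u = e then point_mass u x else 0) -
      (\<Sum>v\<in>V. if fst v = e then point_mass v x else 0) -
      c * point_mass P x - (imbalance U V e (l e) - c) * point_mass Q x" for x
  proof -
    \<comment> \<open>The constant \<open>c\<close> drops out of the jumps, leaving supplies minus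
      demands inside the edge; it survives only in the boundary terms at \<open>P\<close> and
      \<open>Q\<close>.\<close>
    have parts: "(\<Sum>i<Suc k. (S (Suc i) - c - (S i - c)) * point_mass (n (Suc i)) x) =
      (\<Sum>i<Suc k. (S (Suc i) - S i) * point_mass (e, \<tau> i) x)"
      by (intro sum.cong) (auto simp: n_def)
    have ends: "S 0 = 0" "S (Suc k) = imbalance U V e (l e)" "n 0 = P" "n (Suc (Suc k)) = Q"
      by (simp_all add: S_def n_def \<tau>)
    have rearrange: "a = y - z - c * p - q" if "a = (0 - c) * p + (y - z) - q" for a p q y z :: int
      using that by simp
    show ?thesis
      using summation_by_parts[of "\<lambda>i. S i - c" "\<lambda>i. point_mass (n i) x" "Suc k"]
      unfolding parts S_sum ends by (rule rearrange)
  qed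
  have int: "((\<lambda>x. \<bar>real_of_int (imbalance U V e x - c)\<bar>) has_integral
      (\<Sum>i<m. real_of_int \<bar>S (Suc i) - c\<bar> * w (Suc i))) {0..\<tau> m}" if "m \<le> k" for m
    using that
  proof (induction m)
    case 0
    then show ?case using \<tau> by (simp add: has_integral_refl)
  next
    case (Suc m)
    have "\<tau> m < \<tau> (Suc m)" "0 \<le> \<tau> m" using Suc less[of m "Suc m"] le[of 0 m] \<tau> by auto
    have w: "w (Suc m) = \<tau> (Suc m) - \<tau> m" using Suc.prems by (simp add: w_def)
    let ?g = "\<lambda>x. \<bar>real_of_int (imbalance U V e x - c)\<bar>"
      and ?r = "real_of_int \<bar>S (Suc m) - c\<bar>"
    have const: "((\<lambda>x. ?r) has_integral ?r * w (Suc m)) {\<tau> m..\<tau> (Suc m)}"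
      using has_integral_const_real[of ?r "\<tau> m" "\<tau> (Suc m)"] \<open>\<tau> m < \<tau> (Suc m)\<close> unfolding w
      by (simp add: mult.commute)
    \<comment> \<open>The profile is constant on the cell except possibly at its right end, where
      the next jump sits.\<close>
    have "?g x = ?r" if "x \<in> {\<tau> m..\<tau> (Suc m)} - {\<tau> (Suc m)}" for x
      using imb_const[of m x] that Suc.prems by (simp add: S_def)
    then have "(?g has_integral ?r * w (Suc m)) {\<tau> m..\<tau> (Suc m)}"
      using has_integral_spike_finite[OF _ _ const, of "{\<tau> (Suc m)}" ?g] by blast
    moreover have "(?g has_integral (\<Sum>i<m. real_of_int \<bar>S (Suc i) - c\<bar> * w (Suc i))) {0..\<tau> m}"
      using Suc by simp
    ultimately have "(?g has_integral (\<Sum>i<m. real_of_int \<bar>S (Suc i) - c\<bar> * w (Suc i)) +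
        ?r * w (Suc m)) {0..\<tau> (Suc m)}"
      using \<open>0 \<le> \<tau> m\<close> \<open>\<tau> m < \<tau> (Suc m)\<close>
      by (intro has_integral_combine[of 0 "\<tau> m" "\<tau> (Suc m)"]) auto
    then show ?case by simp
  qed
  have "(\<Sum>i\<le>Suc k. real_of_int \<bar>S i - c\<bar> * w i) =
      (\<Sum>i\<le>k. real_of_int \<bar>S i - c\<bar> * w i)"
    by (simp add: w_def)
  also have "\<dots> = (\<Sum>i<k. real_of_int \<bar>S (Suc i) - c\<bar> * w (Suc i))"
    by (subst sum.atMost_shift) (simp add: w_def)
  also have "\<dots> = integral {0..l e} (\<lambda>x. \<bar>real_of_int (imbalance U V e x - c)\<bar>)"
    using int[of k] \<tau> by (simp add: integral_unique)
  finally show ?thesis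
    using route balance
    by (intro exI[of _ "Suc k"] exI[of _ n] exI[of _ "\<lambda>i. S i - c"] exI[of _ w]) blast
qed

text \<open>The edge paths are glued at one location per node. Their boundary terms at a node sum to
  the violation of \<open>flow_feasible\<close>, hence to 0, so the union carries the imbalance of
  \<open>U\<close> and \<open>V\<close> alone and \<open>flow_matching\<close> applies with every
  token starting at its own supply point.\<close>

lemma flow_to_matching:
  assumes G: "fin_digraph G" "\<And>e. e \<in> arcs G \<Longrightarrow> 0 \<le> l e"
    and U: "finite U" "U \<subseteq> locations G l" and V: "finite V" "V \<subseteq> locations G l"
    and card: "card U = card V" and c: "flow_feasible G l U V c"
  shows "\<exists>\<sigma> r. bij_betw \<sigma> U V \<and> (\<forall>u\<in>U. route G l u (\<sigma> u) (r u)) \<and>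
    sum r U \<le> flow_cost G l U V c"
proof -
  interpret fin_digraph G by (rule G(1))
  \<comment> \<open>One location stands for all the locations at a node; it is arbitrary at isolated nodes, which
    are the end of no edge.\<close>
  define rep where "rep v = (SOME a. at_node G l a v)" for v
  let ?imb = "\<lambda>e. imbalance U V e (l e)"
  define path where "path e m n f w \<longleftrightarrow>
    (\<forall>i\<le>m. route G l (n i) (n (Suc i)) (w i) \<and> route G l (n (Suc i)) (n i) (w i) \<and> 0 \<le> w i) \<and>
    (\<forall>x. (\<Sum>i\<le>m. f i * (point_mass (n i) x - point_mass (n (Suc i)) x)) =
      (\<Sum>u\<in>U. if fst u = e then point_mass u x else 0) -
      (\<Sum>v\<in>V. if fst v = e then point_mass v x else 0) -
      c e * point_mass (rep (tail G e)) x - (?imb e - c e) * point_mass (rep (head G e)) x) \<and>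
    (\<Sum>i\<le>m. real_of_int \<bar>f i\<bar> * w i) =
      integral {0..l e} (\<lambda>x. \<bar>real_of_int (imbalance U V e x - c e)\<bar>)"
    for e and m :: nat and n f w
  have "\<exists>m n f w. path e m n f w" if e: "e \<in> arcs G" for e
  proof -
    have "at_node G l (e, 0) (tail G e)" "at_node G l (e, l e) (head G e)"
      using e G(2)[OF e] by (simp_all add: at_node_def locations_Pair)
    then have "at_node G l (rep (tail G e)) (tail G e)" "at_node G l (rep (head G e)) (head G e)"
      unfolding rep_def by (auto intro: someI)
    then show ?thesis
      unfolding path_def by (rule edge_path[OF e U V G(2)[OF e]])
  qed
  then obtain m n f w where path: "path e (m e) (n e) (f e) (w e)" if "e \<in> arcs G" for e
    by metis
  have route: "route G l (n e i) (n e (Suc i)) (w e i) \<and> route G l (n e (Suc i)) (n e i) (w e i) \<and>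
      0 \<le> w e i" if "e \<in> arcs G" "i \<le> m e" for e i
    using path[OF that(1)] that(2) unfolding path_def by blast
  have edge: "(\<Sum>i\<le>m e. f e i * (point_mass (n e i) x - point_mass (n e (Suc i)) x)) =
      (\<Sum>u\<in>U. if fst u = e then point_mass u x else 0) -
      (\<Sum>v\<in>V. if fst v = e then point_mass v x else 0) -
      c e * point_mass (rep (tail G e)) x - (?imb e - c e) * point_mass (rep (head G e)) x"
    if "e \<in> arcs G" for e x
    using path[OF that] unfolding path_def by blast
  have cost: "(\<Sum>i\<le>m e. real_of_int \<bar>f e i\<bar> * w e i) =
      integral {0..l e} (\<lambda>x. \<bar>real_of_int (imbalance U V e x - c e)\<bar>)" if "e \<in> arcs G" for e
    using path[OF that] unfolding path_def by blast
  define A where "A = Sigma (arcs G) (\<lambda>e. {..m e})"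
  have sum_A: "(\<Sum>(e, i)\<in>A. F e i) = (\<Sum>e\<in>arcs G. \<Sum>i\<le>m e. F e i)" for F :: "_ \<Rightarrow> _ \<Rightarrow> 'z::comm_monoid_add"
    unfolding A_def by (rule sum.Sigma[symmetric]) auto
  have loc_sum: "(\<Sum>e\<in>arcs G. \<Sum>a\<in>W. if fst a = e then point_mass a x else 0) = (\<Sum>a\<in>W. point_mass a x)"
    if "W \<subseteq> locations G l" for W x
  proof -
    have "(\<Sum>e\<in>arcs G. \<Sum>a\<in>W. if fst a = e then point_mass a x else 0) =
        (\<Sum>a\<in>W. \<Sum>e\<in>arcs G. if fst a = e then point_mass a x else 0)"
      by (rule sum.swap)
    also have "\<dots> = (\<Sum>a\<in>W. point_mass a x)"
    proof (rule sum.cong[OF refl])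
      fix a assume "a \<in> W"
      then have "fst a \<in> arcs G" using that by (cases a) (auto simp: locations_Pair)
      then show "(\<Sum>e\<in>arcs G. if fst a = e then point_mass a x else 0) = point_mass a x"
        by (subst sum.delta') auto
    qed
    finally show ?thesis .
  qed
  \<comment> \<open>Regrouped by nodes, the coefficient of each \<open>rep v\<close> is the
    constraint at \<open>v\<close>. Two nodes may share a representative, as at an edge of length 0;
    this is harmless, since every coefficient vanishes separately.\<close>
  have node_sum: "(\<Sum>e\<in>arcs G. c e * point_mass (rep (tail G e)) x +
      (?imb e - c e) * point_mass (rep (head G e)) x) = 0" for x
  proof -
    let ?p = "\<lambda>v. point_mass (rep v) x"
    have "c e * ?p (tail G e) + (?imb e - c e) * ?p (head G e) =
        (\<Sum>v\<in>verts G. (incidence_plus G v e * ?imb e - incidence G v e * c e) * ?p v)"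
      if "e \<in> arcs G" for e
    proof -
      have "(\<Sum>v\<in>verts G. (incidence_plus G v e * ?imb e - incidence G v e * c e) * ?p v) =
        (\<Sum>v\<in>verts G. (if tail G e = v then c e * ?p v else 0) +
          (if head G e = v then (?imb e - c e) * ?p v else 0))"
        by (intro sum.cong)
          (auto simp: incidence_def incidence_plus_def incidence_minus_def algebra_simps)
      also have "\<dots> = c e * ?p (tail G e) + (?imb e - c e) * ?p (head G e)"
        using that by (simp add: sum.distrib)
      finally show ?thesis by simp
    qed
    then have "(\<Sum>e\<in>arcs G. c e * ?p (tail G e) + (?imb e - c e) * ?p (head G e)) =
        (\<Sum>e\<in>arcs G. \<Sum>v\<in>verts G. (incidence_plus G v e * ?imb e - incidence G v e * c e) * ?p v)"
      by (intro sum.cong) auto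
    also have "\<dots> = (\<Sum>v\<in>verts G. \<Sum>e\<in>arcs G. (incidence_plus G v e * ?imb e - incidence G v e * c e) * ?p v)"
      by (rule sum.swap)
    also have "\<dots> = (\<Sum>v\<in>verts G. ((\<Sum>e\<in>arcs G. incidence_plus G v e * ?imb e) -
        (\<Sum>e\<in>arcs G. incidence G v e * c e)) * ?p v)"
      by (simp only: sum_subtractf flip: sum_distrib_right)
    also have "\<dots> = 0"
      using c by (intro sum.neutral) (simp add: flow_feasible_def)
    finally show ?thesis .
  qed
  have balance: "(\<Sum>a\<in>A. (case a of (e, i) \<Rightarrow> f e i) *
      (point_mass (case a of (e, i) \<Rightarrow> n e i) x - point_mass (case a of (e, i) \<Rightarrow> n e (Suc i)) x)) =
      (\<Sum>u\<in>U. point_mass u x) - (\<Sum>v\<in>V. point_mass v x)" for x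
  proof -
    have "(\<Sum>a\<in>A. (case a of (e, i) \<Rightarrow> f e i) *
      (point_mass (case a of (e, i) \<Rightarrow> n e i) x - point_mass (case a of (e, i) \<Rightarrow> n e (Suc i)) x)) =
      (\<Sum>(e, i)\<in>A. f e i * (point_mass (n e i) x - point_mass (n e (Suc i)) x))"
      by (intro sum.cong) auto
    also have "\<dots> = (\<Sum>e\<in>arcs G. (\<Sum>u\<in>U. if fst u = e then point_mass u x else 0) -
      (\<Sum>v\<in>V. if fst v = e then point_mass v x else 0) -
      (c e * point_mass (rep (tail G e)) x + (?imb e - c e) * point_mass (rep (head G e)) x))"
      unfolding sum_A by (intro sum.cong) (simp_all add: edge)
    also have "\<dots> = (\<Sum>u\<in>U. point_mass u x) - (\<Sum>v\<in>V. point_mass v x)"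
      by (simp only: sum_subtractf loc_sum[OF U(2)] loc_sum[OF V(2)] node_sum diff_zero)
    finally show ?thesis .
  qed
  have cost_A: "(\<Sum>a\<in>A. real_of_int \<bar>case a of (e, i) \<Rightarrow> f e i\<bar> * (case a of (e, i) \<Rightarrow> w e i)) =
      flow_cost G l U V c"
  proof -
    have "(\<Sum>a\<in>A. real_of_int \<bar>case a of (e, i) \<Rightarrow> f e i\<bar> * (case a of (e, i) \<Rightarrow> w e i)) =
        (\<Sum>(e, i)\<in>A. real_of_int \<bar>f e i\<bar> * w e i)"
      by (intro sum.cong) auto
    also have "\<dots> = flow_cost G l U V c"
      unfolding sum_A flow_cost_eq profile_cost_def by (rule sum.cong[OF refl cost])
    finally show ?thesis .
  qed
  have refl: "route G l v v 0" if "v \<in> V" for v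
    using that V(2) along_edge[of "fst v" "snd v" G l "snd v"] by auto
  have "finite A" by (simp add: A_def)
  show ?thesis
    unfolding cost_A[symmetric]
  proof (rule flow_matching[where R = "route G l" and p = "\<lambda>u. u",
      OF \<open>finite A\<close> U(1) V(1) card balance])
    show "0 \<le> (case a of (e, i) \<Rightarrow> w e i)" if "a \<in> A" for a
      using that route by (auto simp: A_def)
    show "route G l (case a of (e, i) \<Rightarrow> n e i) (case a of (e, i) \<Rightarrow> n e (Suc i)) (case a of (e, i) \<Rightarrow> w e i)"
      if "a \<in> A" for a
      using that route by (auto simp: A_def)
    show "route G l (case a of (e, i) \<Rightarrow> n e (Suc i)) (case a of (e, i) \<Rightarrow> n e i) (case a of (e, i) \<Rightarrow> w e i)"
      if "a \<in> A" for a
      using that route by (auto simp: A_def)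
    show "route G l v v 0" if "v \<in> V" for v by (rule refl[OF that])
    show "route G l a b (r + s)" if "route G l a d r" "route G l d b s" for a b d r s
      using that by (rule route.concat)
  qed
qed

subsection \<open>Optimal values\<close>

lemma route_nonneg: "route G l a b r \<Longrightarrow> 0 \<le> r"
  by (induction rule: route.induct) auto

lemma network_dist_nonneg: "0 \<le> network_dist G l a b"
  unfolding network_dist_def by (rule Inf_greatest) (auto dest: route_nonneg)

lemma network_dist_le: "route G l a b r \<Longrightarrow> network_dist G l a b \<le> ereal r"
  unfolding network_dist_def by (rule Inf_lower) auto

section \<open>Feasible matchings as bijections\<close>

lemma ex1_of_sum_01_eq_1:
  fixes g :: "'a \<Rightarrow> real"
  assumes "finite B" "\<And>b. b \<in> B \<Longrightarrow> g b \<in> {0, 1}" "sum g B = 1"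
  shows "\<exists>!b. b \<in> B \<and> g b = 1"
proof -
  have "sum g B = (\<Sum>b\<in>B. if g b = 1 then 1 else 0)"
    using assms(2) by (intro sum.cong) auto
  also have "\<dots> = real (card {b \<in> B. g b = 1})"
    using assms(1) by (simp flip: sum.inter_filter)
  finally have "card {b \<in> B. g b = 1} = 1" using assms(3) by simp
  then obtain b where "{b \<in> B. g b = 1} = {b}" by (rule card_1_singletonE)
  then have "b' \<in> B \<and> g b' = 1 \<longleftrightarrow> b' = b" for b' by blast
  then show ?thesis by metis
qed

lemma matching_feasible_bij:
  assumes fin: "finite U" "finite V" and y: "matching_feasible U V y"
  obtains \<sigma> where "bij_betw \<sigma> U V" "\<And>u v. u \<in> U \<Longrightarrow> v \<in> V \<Longrightarrow> y u v = (if v = \<sigma> u then 1 else 0)"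
proof -
  have y01: "y u v \<in> {0, 1}" if "u \<in> U" "v \<in> V" for u v
    using y that unfolding matching_feasible_def by blast
  have row: "\<exists>!v. v \<in> V \<and> y u v = 1" if "u \<in> U" for u
    using y that fin y01 by (intro ex1_of_sum_01_eq_1) (auto simp: matching_feasible_def)
  have col: "\<exists>!u. u \<in> U \<and> y u v = 1" if "v \<in> V" for v
    using y that fin y01
    by (intro ex1_of_sum_01_eq_1[of U "\<lambda>u. y u v"]) (auto simp: matching_feasible_def)
  define \<sigma> where "\<sigma> u = (THE v. v \<in> V \<and> y u v = 1)" for u
  have \<sigma>: "\<sigma> u \<in> V" "y u (\<sigma> u) = 1" if "u \<in> U" for u
    using theI'[OF row[OF that]] by (auto simp: \<sigma>_def)
  have "inj_on \<sigma> U"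
  proof (rule inj_onI)
    fix u u' assume "u \<in> U" "u' \<in> U" "\<sigma> u = \<sigma> u'"
    then show "u = u'" using \<sigma>[of u] \<sigma>[of u'] col[of "\<sigma> u"] by auto
  qed
  moreover have "v \<in> \<sigma> ` U" if v: "v \<in> V" for v
  proof -
    obtain u where u: "u \<in> U" "y u v = 1" using col[OF v] by blast
    then have "v = \<sigma> u" using \<sigma>[of u] row[of u] v by blast
    with u show ?thesis by blast
  qed
  then have "\<sigma> ` U = V" using \<sigma>(1) by blast
  moreover have "y u v = (if v = \<sigma> u then 1 else 0)" if "u \<in> U" "v \<in> V" for u v
    using \<sigma>[OF that(1)] row[OF that(1)] y01[OF that] that(2) by auto
  ultimately show ?thesis using that by (auto simp: bij_betw_def)
qed

lemma bij_matching_feasible: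
  assumes fin: "finite U" "finite V" and \<sigma>: "bij_betw \<sigma> U V"
  shows "matching_feasible U V (\<lambda>u v. if v = \<sigma> u then 1 else 0)"
proof -
  have "(\<Sum>u\<in>U. if v = \<sigma> u then 1 else 0) = (1::real)" if "v \<in> V" for v
    using sum.reindex_bij_betw[OF \<sigma>, of "\<lambda>w. if v = w then 1 else (0::real)"] that fin by simp
  moreover have "\<sigma> u \<in> V" if "u \<in> U" for u using \<sigma> that by (auto dest: bij_betwE)
  ultimately show ?thesis using fin by (simp add: matching_feasible_def)
qed

lemma matching_cost_bij:
  assumes fin: "finite U" "finite V" and \<sigma>: "bij_betw \<sigma> U V"
    and y: "\<And>u v. u \<in> U \<Longrightarrow> v \<in> V \<Longrightarrow> y u v = (if v = \<sigma> u then 1 else 0)"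
  shows "matching_cost G l U V y = (\<Sum>u\<in>U. network_dist G l u (\<sigma> u))"
  unfolding matching_cost_def
proof (rule sum.cong[OF refl])
  fix u assume u: "u \<in> U"
  then have "\<sigma> u \<in> V" using \<sigma> by (auto dest: bij_betwE)
  \<comment> \<open>Unmatched pairs contribute 0 even at infinite distance, as
    \<open>0 * \<infinity> = 0\<close> in \<open>ereal\<close>.\<close>
  have "(\<Sum>v\<in>V. ereal (y u v) * network_dist G l u v) =
      (\<Sum>v\<in>V. if v = \<sigma> u then network_dist G l u v else 0)"
    using u by (intro sum.cong) (auto simp: y simp flip: zero_ereal_def one_ereal_def)
  with fin \<open>\<sigma> u \<in> V\<close> show "(\<Sum>v\<in>V. ereal (y u v) * network_dist G l u v) = network_dist G l u (\<sigma> u)"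
    by simp
qed

text \<open>Only values up to \<open>f x0\<close> compete. Finiteness is asked of the values, not of
  the arguments: matchings are arbitrary off \<open>U\<close> and \<open>V\<close>, and flows off
  \<open>arcs G\<close>, so infinitely many arguments can share a value.\<close>

lemma ex_is_arg_min_finite_values:
  fixes f :: "'a \<Rightarrow> 'b::linorder"
  assumes "P x0" "finite (f ` {x. P x \<and> f x \<le> f x0})"
  shows "\<exists>x. is_arg_min f P x"
proof -
  let ?S = "f ` {x. P x \<and> f x \<le> f x0}"
  have "?S \<noteq> {}" using assms(1) by auto
  then have "Min ?S \<in> ?S" using assms(2) by (rule Min_in[rotated])
  then obtain x where x: "P x" "f x \<le> f x0" "f x = Min ?S" by auto
  have "f x \<le> f y" if "P y" for y
  proof (cases "f y \<le> f x0")
    case True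
    with that have "f y \<in> ?S" by auto
    then show ?thesis using x(3) Min_le[OF assms(2)] by simp
  next
    case False
    then show ?thesis using x(2) by simp
  qed
  with x(1) show ?thesis by (auto simp: is_arg_min_linorder)
qed

section \<open>Inequalities between the two optimal values\<close>

lemma Z_CF_le_matching_cost:
  assumes G: "fin_digraph G" "\<And>e. e \<in> arcs G \<Longrightarrow> 0 \<le> l e"
    and fin: "finite U" "finite V" and y: "matching_feasible U V y"
  shows "Z_CF G l U V \<le> matching_cost G l U V y"
proof -
  obtain \<sigma> where \<sigma>: "bij_betw \<sigma> U V"
    and y\<sigma>: "\<And>u v. u \<in> U \<Longrightarrow> v \<in> V \<Longrightarrow> y u v = (if v = \<sigma> u then 1 else 0)"
    using matching_feasible_bij[OF fin y] by blast
  have cost: "matching_cost G l U V y = (\<Sum>u\<in>U. network_dist G l u (\<sigma> u))"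
    by (rule matching_cost_bij[OF fin \<sigma> y\<sigma>])
  show ?thesis
  proof (cases "\<exists>u\<in>U. network_dist G l u (\<sigma> u) = \<infinity>")
    case True
    then have "matching_cost G l U V y = \<infinity>"
      using fin by (simp add: cost sum_Pinfty)
    then show ?thesis by simp
  next
    case False
    define d where "d u = real_of_ereal (network_dist G l u (\<sigma> u))" for u
    have d: "network_dist G l u (\<sigma> u) = ereal (d u)" if "u \<in> U" for u
      using False that network_dist_nonneg[of G l u "\<sigma> u"] unfolding d_def
      by (intro ereal_real'[symmetric]) auto
    have cost_d: "matching_cost G l U V y = ereal (sum d U)"
      by (simp add: cost d)
    show ?thesis
    proof (rule ereal_le_epsilon2)
      fix \<epsilon> :: real assume "0 < \<epsilon>"
      \<comment> \<open>The distance is defined as an infimum of route lengths, so routes within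
        \<open>\<delta>\<close> of it are used; the \<open>+ 1\<close> keeps \<open>\<delta>\<close>
        positive for empty \<open>U\<close>.\<close>
      define \<delta> where "\<delta> = \<epsilon> / (real (card U) + 1)"
      have \<delta>: "0 < \<delta>" "real (card U) * \<delta> \<le> \<epsilon>"
        using \<open>0 < \<epsilon>\<close> by (auto simp: \<delta>_def field_simps)
      have "\<exists>r. route G l u (\<sigma> u) r \<and> r < d u + \<delta>" if "u \<in> U" for u
      proof -
        have "Inf {ereal r | r. route G l u (\<sigma> u) r} < ereal (d u + \<delta>)"
          using d[OF that] \<delta>(1) by (simp flip: network_dist_def)
        then show ?thesis unfolding Inf_less_iff by auto
      qed
      then obtain r where r: "\<And>u. u \<in> U \<Longrightarrow> route G l u (\<sigma> u) (r u)" "\<And>u. u \<in> U \<Longrightarrow> r u < d u + \<delta>"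
        by metis
      obtain c where c: "flow_feasible G l U V c" "flow_cost G l U V c \<le> sum r U"
        using matching_to_flow[OF G fin \<sigma> r(1)] by blast
      have "sum r U \<le> (\<Sum>u\<in>U. d u + \<delta>)"
        using r(2) by (intro sum_mono) (simp add: less_imp_le)
      also have "\<dots> \<le> sum d U + \<epsilon>"
        using \<delta>(2) by (simp add: sum.distrib)
      finally have "flow_cost G l U V c \<le> sum d U + \<epsilon>" using c(2) by simp
      then have "ereal (flow_cost G l U V c) \<le> matching_cost G l U V y + ereal \<epsilon>"
        by (simp add: cost_d)
      moreover have "Z_CF G l U V \<le> ereal (flow_cost G l U V c)"
        unfolding Z_CF_def using c(1) by (intro Inf_lower) auto
      ultimately show "Z_CF G l U V \<le> matching_cost G l U V y + ereal \<epsilon>" by (rule order_trans[rotated])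
    qed
  qed
qed

lemma Z_IP_le_flow_cost:
  assumes G: "fin_digraph G" "\<And>e. e \<in> arcs G \<Longrightarrow> 0 \<le> l e"
    and U: "finite U" "U \<subseteq> locations G l" and V: "finite V" "V \<subseteq> locations G l"
    and card: "card U = card V" and c: "flow_feasible G l U V c"
  shows "Z_IP G l U V \<le> ereal (flow_cost G l U V c)"
proof -
  obtain \<sigma> r where \<sigma>: "bij_betw \<sigma> U V" and r: "\<forall>u\<in>U. route G l u (\<sigma> u) (r u)"
    and cost: "sum r U \<le> flow_cost G l U V c"
    using flow_to_matching[OF G U V card c] by blast
  let ?y = "\<lambda>u v. if v = \<sigma> u then 1 else (0::real)"
  have "Z_IP G l U V \<le> matching_cost G l U V ?y"
    unfolding Z_IP_def using bij_matching_feasible[OF U(1) V(1) \<sigma>] by (intro Inf_lower) auto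
  also have "\<dots> = (\<Sum>u\<in>U. network_dist G l u (\<sigma> u))"
    by (rule matching_cost_bij[OF U(1) V(1) \<sigma>]) simp
  also have "\<dots> \<le> (\<Sum>u\<in>U. ereal (r u))"
    using r by (intro sum_mono network_dist_le) auto
  also have "\<dots> \<le> ereal (flow_cost G l U V c)"
    using cost by simp
  finally show ?thesis .
qed

section \<open>Attainment of the minima\<close>

lemma matching_arg_min_exists:
  assumes fin: "finite U" "finite V" and card: "card U = card V"
  shows "\<exists>y. is_arg_min (matching_cost G l U V) (matching_feasible U V) y"
proof -
  obtain \<sigma> where "bij_betw \<sigma> U V"
    using finite_same_card_bij[OF fin card] by blast
  then have feas: "matching_feasible U V (\<lambda>u v. if v = \<sigma> u then 1 else 0)"
    by (rule bij_matching_feasible[OF fin])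
  \<comment> \<open>A feasible \<open>y\<close> costs as much as its bijection restricted to
    \<open>U\<close>, and there are finitely many such functions.\<close>
  have "matching_cost G l U V y \<in> (\<lambda>\<tau>. \<Sum>u\<in>U. network_dist G l u (\<tau> u)) ` (U \<rightarrow>\<^sub>E V)"
    if y: "matching_feasible U V y" for y
  proof -
    obtain \<tau> where \<tau>: "bij_betw \<tau> U V"
      and y\<tau>: "\<And>u v. u \<in> U \<Longrightarrow> v \<in> V \<Longrightarrow> y u v = (if v = \<tau> u then 1 else 0)"
      using matching_feasible_bij[OF fin y] by blast
    have "restrict \<tau> U \<in> U \<rightarrow>\<^sub>E V" using \<tau> by (auto dest: bij_betwE)
    moreover have "matching_cost G l U V y = (\<Sum>u\<in>U. network_dist G l u (restrict \<tau> U u))"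
      using matching_cost_bij[OF fin \<tau> y\<tau>] by simp
    ultimately show ?thesis by blast
  qed
  then have "matching_cost G l U V ` {y. matching_feasible U V y \<and>
      matching_cost G l U V y \<le> matching_cost G l U V (\<lambda>u v. if v = \<sigma> u then 1 else 0)} \<subseteq>
      (\<lambda>\<tau>. \<Sum>u\<in>U. network_dist G l u (\<tau> u)) ` (U \<rightarrow>\<^sub>E V)"
    by blast
  moreover have "finite (U \<rightarrow>\<^sub>E V)" using fin by (simp add: finite_PiE)
  ultimately have "finite (matching_cost G l U V ` {y. matching_feasible U V y \<and>
      matching_cost G l U V y \<le> matching_cost G l U V (\<lambda>u v. if v = \<sigma> u then 1 else 0)})"
    by (rule finite_subset[OF _ finite_imageI])
  with feas show ?thesis by (rule ex_is_arg_min_finite_values)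
qed

lemma flow_arg_min_exists:
  assumes G: "fin_digraph G" "\<And>e. e \<in> arcs G \<Longrightarrow> 0 \<le> l e"
    and fin: "finite U" "finite V" and c0: "flow_feasible G l U V c0"
  shows "\<exists>c. is_arg_min (flow_cost G l U V) (flow_feasible G l U V) c"
proof (rule ex_is_arg_min_finite_values[of _ c0])
  interpret fin_digraph G by (rule G(1))
  let ?F = "flow_cost G l U V" and ?E = "{e \<in> arcs G. 0 < l e}"
  \<comment> \<open>\<open>M\<close> bounds every \<open>|S_e(x)|\<close>. Integrating
    \<open>|c e| - M \<le> |S_e(x) - c e|\<close> over an edge of positive length and bounding the
    result by the total cost at \<open>c0\<close> gives \<open>b e\<close>.\<close>
  define M where "M = real (card U + card V)"
  define b where "b e = \<lceil>?F c0 / l e + M\<rceil>" for e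
  let ?I = "\<lambda>c e. integral {0..l e} (\<lambda>x. \<bar>real_of_int (imbalance U V e x - c e)\<bar>)"
  have F: "?F c = sum (?I c) (arcs G)" for c
    by (simp add: flow_cost_eq profile_cost_def)
  have int: "(\<lambda>x. \<bar>real_of_int (imbalance U V e x - c e)\<bar>) integrable_on {0..l e}"
    if "e \<in> arcs G" for c e
  proof -
    have "profile_integrable G l (\<lambda>e x. imbalance U V e x - c e)"
      unfolding imbalance_eq_passed[OF fin]
      by (intro profile_integrable_diff profile_integrable_sum profile_integrable_passed
          profile_integrable_const fin)
    with that show ?thesis by (simp add: profile_integrable_def absolutely_integrable_on_def)
  qed
  have imb: "\<bar>real_of_int (imbalance U V e x)\<bar> \<le> M" for e x
  proof -
    have "card (U \<inter> initial_part e x) \<le> card U" "card (V \<inter> initial_part e x) \<le> card V"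
      using fin by (auto intro: card_mono)
    then show ?thesis by (simp add: imbalance_def M_def)
  qed
  have bound: "\<bar>c e\<bar> \<le> b e" if c: "?F c \<le> ?F c0" and e: "e \<in> ?E" for c e
  proof -
    have "l e * (\<bar>real_of_int (c e)\<bar> - M) = integral {0..l e} (\<lambda>x. \<bar>real_of_int (c e)\<bar> - M)"
      using e by simp
    also have "\<dots> \<le> ?I c e"
    proof (rule integral_le)
      show "\<bar>real_of_int (c e)\<bar> - M \<le> \<bar>real_of_int (imbalance U V e x - c e)\<bar>" for x
        using imb[of e x] by simp
    qed (use e int in auto)
    also have "\<dots> \<le> sum (?I c) (arcs G)"
      using e int by (intro member_le_sum) (auto intro: integral_nonneg)
    finally have "l e * (\<bar>real_of_int (c e)\<bar> - M) \<le> ?F c0"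
      using c F[of c] by linarith
    then have "\<bar>real_of_int (c e)\<bar> \<le> ?F c0 / l e + M"
      using e by (simp add: field_simps)
    then show ?thesis unfolding b_def by linarith
  qed
  \<comment> \<open>Values on edges of length 0 do not affect the cost. The restriction need not be
    feasible: it only has to reproduce the value of \<open>?F\<close> while ranging over a finite
    set.\<close>
  have "?F (restrict c ?E) = ?F c" for c
    unfolding F
  proof (rule sum.cong[OF refl])
    fix e assume "e \<in> arcs G"
    then show "?I (restrict c ?E) e = ?I c e"
      using G(2)[of e] by (cases "l e = 0") auto
  qed
  moreover have "restrict c ?E \<in> Pi\<^sub>E ?E (\<lambda>e. {- b e..b e})" if "?F c \<le> ?F c0" for c
    using bound[OF that] by (auto simp: abs_le_iff minus_le_iff)
  ultimately have "?F ` {c. flow_feasible G l U V c \<and> ?F c \<le> ?F c0} \<subseteq>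
      ?F ` Pi\<^sub>E ?E (\<lambda>e. {- b e..b e})"
    by (smt (verit) image_eqI image_subsetI mem_Collect_eq)
  then show "finite (?F ` {c. flow_feasible G l U V c \<and> ?F c \<le> ?F c0})"
    by (rule finite_subset) (intro finite_imageI finite_PiE; simp)
qed (rule c0)

theorem theorem1:
  fixes G :: "('v, 'e) pre_digraph" and l :: "'e \<Rightarrow> real"
    and U V :: "'e location set" and n :: nat
  assumes "fin_digraph G"
    and "\<And>e. e \<in> arcs G \<Longrightarrow> l e \<ge> 0"
    and "U \<subseteq> locations G l" and "V \<subseteq> locations G l"
    and "finite U" and "finite V"
    and "card U = n" and "card V = n"
  shows "Z_IP G l U V = Z_CF G l U V
    \<and> (\<exists>y. is_arg_min (matching_cost G l U V) (matching_feasible U V) y)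
    \<and> ((\<exists>c. flow_feasible G l U V c) \<longrightarrow>
        (\<exists>c. is_arg_min (flow_cost G l U V) (flow_feasible G l U V) c))"
proof (intro conjI impI)
  have card: "card U = card V" using assms by simp
  show "Z_IP G l U V = Z_CF G l U V"
  proof (rule antisym)
    show "Z_IP G l U V \<le> Z_CF G l U V"
      unfolding Z_CF_def
      using Z_IP_le_flow_cost[OF assms(1,2,5,3,6,4) card] by (intro Inf_greatest) auto
    show "Z_CF G l U V \<le> Z_IP G l U V"
      unfolding Z_IP_def
      using Z_CF_le_matching_cost[OF assms(1,2,5,6)] by (intro Inf_greatest) auto
  qed
  show "\<exists>y. is_arg_min (matching_cost G l U V) (matching_feasible U V) y"
    using assms card by (intro matching_arg_min_exists)
  show "\<exists>c. is_arg_min (flow_cost G l U V) (flow_feasible G l U V) c"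
    if "\<exists>c. flow_feasible G l U V c"
    using that by (elim exE) (rule flow_arg_min_exists[OF assms(1,2,5,6)])
qed

end
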